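(* Let $e\ge 2$ and $\ell\ge 1$ be integers. Let $\boldsymbol\lambda\in\mathcal P^{\ell}$ be an $\ell$-partition and $\mathbf t\in\mathbb Z^{\ell}$, and let $(\boldsymbol\mu;\mathbf u)\in(\boldsymbol\lambda;\mathbf t)^{\widehat{\mathbf W}_{\ell}}$ be an element of the orbit of $(\boldsymbol\lambda;\mathbf t)$ under the right action of $\widehat{\mathbf W}_\ell$ on $\mathcal P^\ell\times\mathbb Z^\ell$. Then: (1) $\mathsf{core}_e(\boldsymbol\mu;\mathbf u)=\mathsf{core}_e(\boldsymbol\lambda;\mathbf t)$. (2) $\mathsf{wt}_e(\boldsymbol\mu;\mathbf u)=\min\{\mathsf{wt}_e(\boldsymbol\nu;\mathbf v)\mid(\boldsymbol\nu;\mathbf v)\in(\boldsymbol\lambda;\mathbf t)^{\widehat{\mathbf W}_{\ell}}\}$ if and only if $\mathbf u=(u_1,\dots,u_\ell)$ satisfies $u_1\le u_2\le\dots\le u_\ell\le u_1+e$.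
   Context: **Partitions, $\beta$-sets.** $\mathcal P$ is the set of all partitions, i.e. weakly decreasing infinite sequences $\lambda=(\lambda_1,\lambda_2,\dots)$ of nonnegative integers that are eventually zero; $\mathcal P^\ell$ is the set of $\ell$-partitions $\boldsymbol\lambda=(\lambda^{(1)},\dots,\lambda^{(\ell)})$. A $\beta$-set is a subset $\mathsf B\subseteq\mathbb Z$ such that $\max(\mathsf B)$ and $\min(\mathbb Z\setminus\mathsf B)$ exist; its charge is $\mathcal s(\mathsf B)=|\mathsf B\cap\mathbb Z_{\ge0}|-|\mathbb Z_{<0}\setminus\mathsf B|$. For $\lambda\in\mathcal P$ and $t\in\mathbb Z$, $\beta_t(\lambda)=\{\lambda_a+t-a\mid a\in\mathbb Z^+\}$ is a $\beta$-set of charge $t$, and $(t,\lambda)\mapsto\beta_t(\lambda)$ is a bijection from $\mathbb Z\times\mathcal P$ to the set of $\beta$-sets. For a $\beta$-set $\mathsf B$, $\beta^{-1}(\mathsf B)$ denotes the unique partition $\lambda$ with $\beta_{\mathcal s(\mathsf B)}(\lambda)=\mathsf B$. **Cores and weights of $\beta$-sets.** For a $\beta$-set $\mathsf B$ and $0\le i\le e-1$ put $\mathsf B_i=\{a\in\mathbb Z\mid ae+i\in\mathsf B\}$ (a $\beta$-set), with elements $b_{i1}>b_{i2}>\cdots$. Then $$\mathsf{core}_e(\mathsf B)=\bigcup_{i=0}^{e-1}\{ae+i\mid a<\mathcal s(\mathsf B_i)\},\qquad \mathsf{wt}_e(\mathsf B)=\sum_{i=0}^{e-1}\sum_{a\ge1}(b_{ia}-\mathcal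 s(\mathsf B_i)+a),$$ the latter being a finite sum. **Uglov map.** For $1\le j\le\ell$ and $x=ae+b$ with $a,b\in\mathbb Z$, $0\le b<e$, let $\upsilon_j(x)=ae\ell+(\ell-j)e+b$. For $\beta$-sets $\mathsf B^{(1)},\dots,\mathsf B^{(\ell)}$ let $\mathbf U(\mathsf B^{(1)},\dots,\mathsf B^{(\ell)})=\bigcup_{j=1}^{\ell}\upsilon_j(\mathsf B^{(j)})$, which is a $\beta$-set. For $\boldsymbol\lambda\in\mathcal P^\ell$ and $\mathbf t=(t_1,\dots,t_\ell)\in\mathbb Z^\ell$ let $\beta_{\mathbf t}(\boldsymbol\lambda)=(\beta_{t_1}(\lambda^{(1)}),\dots,\beta_{t_\ell}(\lambda^{(\ell)}))$ and define $$\mathsf{core}_e(\boldsymbol\lambda;\mathbf t)=\beta^{-1}(\mathsf{core}_e(\mathbf U(\beta_{\mathbf t}(\boldsymbol\lambda))))\in\mathcal P,\qquad \mathsf{wt}_e(\boldsymbol\lambda;\mathbf t)=\mathsf{wt}_e(\mathbf U(\beta_{\mathbf t}(\boldsymbol\lambda)))\in\mathbb Z.$$ **Action of $\widehat{\mathbf W}_\ell$.** The symmetric group $\mathfrak S_\ell$ (permutations composed from right to left) acts on the right on $\ell$-tuples by $(x_1,\dots,x_\ell)^\sigma=(x_{\sigma(1)},\dots,x_{\sigma(\ell)})$. The extended affine Weyl group is $\widehat{\mathbf W}_\ell=\mathbb Z^\ell\rtimes\mathfrak S_\ell$; each element is uniquely $\sigma\mathbf u$ with $\sigma\in\mathfrak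 S_\ell$, $\mathbf u\in\mathbb Z^\ell$, and $\mathbf u\sigma=\sigma\mathbf u^\sigma$. It acts on the right on $\mathcal P^\ell\times\mathbb Z^\ell$ by $(\boldsymbol\lambda;\mathbf t)^{\sigma\mathbf u}=(\boldsymbol\lambda^\sigma;\mathbf t^\sigma+e\mathbf u)$. $(\boldsymbol\lambda;\mathbf t)^{\widehat{\mathbf W}_\ell}$ denotes the orbit. *)

theory Defs
  imports
    "HOL-Library.FuncSet"
    "HOL-Library.Groups_Big_Fun"
    "HOL-Combinatorics.Permutations"
    "HOL-Algebra.Group"
begin

text \<open>Partitions are infinite sequences, indexed from 0: \<open>lam a\<close> is the part with number \<open>a + 1\<close>.\<close>

definition partitions :: "(nat \<Rightarrow> nat) set" where
  "partitions = {lam. antimono lam \<and> (\<exists>N. \<forall>a\<ge>N. lam a = 0)}"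

text \<open>Tuples with \<open>l\<close> components are extensional functions on \<open>{1..l}\<close>.\<close>

definition multipartitions :: "nat \<Rightarrow> (nat \<Rightarrow> nat \<Rightarrow> nat) set" where
  "multipartitions l = {1..l} \<rightarrow>\<^sub>E partitions"

definition multicharges :: "nat \<Rightarrow> (nat \<Rightarrow> int) set" where
  "multicharges l = {1..l} \<rightarrow>\<^sub>E UNIV"


text \<open>The functions on \<beta>-sets below are total on \<open>int set\<close>; they are meaningful on sets satisfying
  \<open>is_beta_set\<close>, to which they are only ever applied.\<close>

definition is_beta_set :: "int set \<Rightarrow> bool" where
  "is_beta_set B \<longleftrightarrow> (\<exists>m\<in>B. \<forall>x\<in>B. x \<le> m) \<and> (\<exists>m\<in>- B. \<forall>x\<in>- B. m \<le> x)"

definition charge :: "int set \<Rightarrow> int" where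
  "charge B = int (card (B \<inter> {0..})) - int (card ({..<0} - B))"

definition beta :: "int \<Rightarrow> (nat \<Rightarrow> nat) \<Rightarrow> int set" where
  "beta t lam = {int (lam a) + t - int (Suc a) | a. True}"

definition beta_inv :: "int set \<Rightarrow> (nat \<Rightarrow> nat)" where
  "beta_inv B = (THE lam. lam \<in> partitions \<and> beta (charge B) lam = B)"

definition runner :: "nat \<Rightarrow> int set \<Rightarrow> nat \<Rightarrow> int set" where
  "runner e B i = {a. a * int e + int i \<in> B}"

text \<open>The elements of a \<beta>-set in decreasing order, numbered from 0.\<close>

definition desc_enum :: "int set \<Rightarrow> nat \<Rightarrow> int" where
  "desc_enum B = (THE b. (\<forall>n. b (Suc n) < b n) \<and> range b = B)"

definition core :: "nat \<Rightarrow> int set \<Rightarrow> int set" where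
  "core e B = (\<Union>i<e. {a * int e + int i | a. a < charge (runner e B i)})"

text \<open>\<open>Sum_any\<close> is the sum of a finitely supported function. The summand \<open>Suc a\<close> appears because of
  the numbering from 0.\<close>

definition wt :: "nat \<Rightarrow> int set \<Rightarrow> int" where
  "wt e B = (\<Sum>i<e. Sum_any (\<lambda>a. desc_enum (runner e B i) a - charge (runner e B i) + int (Suc a)))"


definition upsilon :: "nat \<Rightarrow> nat \<Rightarrow> nat \<Rightarrow> int \<Rightarrow> int" where
  "upsilon e l j x = (x div int e) * int e * int l + (int l - int j) * int e + x mod int e"

definition uglov :: "nat \<Rightarrow> nat \<Rightarrow> (nat \<Rightarrow> int set) \<Rightarrow> int set" where
  "uglov e l Bs = (\<Union>j\<in>{1..l}. upsilon e l j ` Bs j)"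

definition multibeta :: "nat \<Rightarrow> (nat \<Rightarrow> int) \<Rightarrow> (nat \<Rightarrow> nat \<Rightarrow> nat) \<Rightarrow> nat \<Rightarrow> int set" where
  "multibeta l t lam = (\<lambda>j\<in>{1..l}. beta (t j) (lam j))"

definition multicore :: "nat \<Rightarrow> nat \<Rightarrow> (nat \<Rightarrow> nat \<Rightarrow> nat) \<Rightarrow> (nat \<Rightarrow> int) \<Rightarrow> (nat \<Rightarrow> nat)" where
  "multicore e l lam t = beta_inv (core e (uglov e l (multibeta l t lam)))"

definition multiwt :: "nat \<Rightarrow> nat \<Rightarrow> (nat \<Rightarrow> nat \<Rightarrow> nat) \<Rightarrow> (nat \<Rightarrow> int) \<Rightarrow> int" where
  "multiwt e l lam t = wt e (uglov e l (multibeta l t lam))"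


definition tuple_perm :: "nat \<Rightarrow> (nat \<Rightarrow> 'a) \<Rightarrow> (nat \<Rightarrow> nat) \<Rightarrow> (nat \<Rightarrow> 'a)" where
  "tuple_perm l x \<sigma> = (\<lambda>j\<in>{1..l}. x (\<sigma> j))"

text \<open>The pair \<open>(\<sigma>, u)\<close> stands for the element \<open>\<sigma> u\<close>, with the permutation on the left; the
  multiplication is \<open>(\<sigma> u) (\<tau> v) = \<sigma> \<tau> (u\<^sup>\<tau> + v)\<close>, which is forced by \<open>u \<tau> = \<tau> u\<^sup>\<tau>\<close>.\<close>

definition ext_affine_weyl :: "nat \<Rightarrow> ((nat \<Rightarrow> nat) \<times> (nat \<Rightarrow> int)) monoid" where
  "ext_affine_weyl l =
    \<lparr>carrier = {\<sigma>. \<sigma> permutes {1..l}} \<times> ({1..l} \<rightarrow>\<^sub>E UNIV),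
     monoid.mult = (\<lambda>(\<sigma>, u) (\<tau>, v). (\<sigma> \<circ> \<tau>, \<lambda>j\<in>{1..l}. tuple_perm l u \<tau> j + v j)),
     one = (id, \<lambda>j\<in>{1..l}. 0)\<rparr>"

fun weyl_act ::
  "nat \<Rightarrow> nat \<Rightarrow> (nat \<Rightarrow> nat \<Rightarrow> nat) \<times> (nat \<Rightarrow> int) \<Rightarrow> (nat \<Rightarrow> nat) \<times> (nat \<Rightarrow> int)
    \<Rightarrow> (nat \<Rightarrow> nat \<Rightarrow> nat) \<times> (nat \<Rightarrow> int)" where
  "weyl_act e l (lam, t) (\<sigma>, u) =
    (tuple_perm l lam \<sigma>, \<lambda>j\<in>{1..l}. tuple_perm l t \<sigma> j + int e * u j)"

definition weyl_orbit ::
  "nat \<Rightarrow> nat \<Rightarrow> (nat \<Rightarrow> nat \<Rightarrow> nat) \<times> (nat \<Rightarrow> int) \<Rightarrow> ((nat \<Rightarrow> nat \<Rightarrow> nat) \<times> (nat \<Rightarrow> int)) set" where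
  "weyl_orbit e l x = weyl_act e l x ` carrier (ext_affine_weyl l)"

text \<open>\<open>m = min S\<close>; the operator \<open>Min\<close> is of no use here as it is specified on finite sets only.\<close>

definition is_minimum :: "'a::linorder set \<Rightarrow> 'a \<Rightarrow> bool" where
  "is_minimum S m \<longleftrightarrow> m \<in> S \<and> (\<forall>x\<in>S. m \<le> x)"


lemma tuple_perm_apply [simp]: "j \<in> {1..l} \<Longrightarrow> tuple_perm l x \<sigma> j = x (\<sigma> j)"
  by (simp add: tuple_perm_def)

lemma permutes_mem:
  fixes l :: nat
  assumes "\<sigma> permutes {Suc 0..l}" "Suc 0 \<le> j" "j \<le> l"
  shows "Suc 0 \<le> \<sigma> j" "\<sigma> j \<le> l"
  using permutes_in_image[OF assms(1), of j] assms(2,3) by auto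

lemma group_ext_affine_weyl: "group (ext_affine_weyl l)"
proof (rule groupI)
  fix x y assume "x \<in> carrier (ext_affine_weyl l)" "y \<in> carrier (ext_affine_weyl l)"
  then show "x \<otimes>\<^bsub>ext_affine_weyl l\<^esub> y \<in> carrier (ext_affine_weyl l)"
    by (auto simp: ext_affine_weyl_def permutes_compose)
next
  show "\<one>\<^bsub>ext_affine_weyl l\<^esub> \<in> carrier (ext_affine_weyl l)"
    by (auto simp: ext_affine_weyl_def permutes_id)
next
  fix x y z
  assume "x \<in> carrier (ext_affine_weyl l)" "y \<in> carrier (ext_affine_weyl l)"
    "z \<in> carrier (ext_affine_weyl l)"
  then show "x \<otimes>\<^bsub>ext_affine_weyl l\<^esub> y \<otimes>\<^bsub>ext_affine_weyl l\<^esub> z =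
      x \<otimes>\<^bsub>ext_affine_weyl l\<^esub> (y \<otimes>\<^bsub>ext_affine_weyl l\<^esub> z)"
    by (auto simp: ext_affine_weyl_def comp_assoc fun_eq_iff restrict_def tuple_perm_def
        dest: permutes_mem)
next
  fix x assume "x \<in> carrier (ext_affine_weyl l)"
  then show "\<one>\<^bsub>ext_affine_weyl l\<^esub> \<otimes>\<^bsub>ext_affine_weyl l\<^esub> x = x"
    by (auto simp: ext_affine_weyl_def fun_eq_iff restrict_def tuple_perm_def PiE_def
        extensional_def dest: permutes_mem)
next
  fix x assume x: "x \<in> carrier (ext_affine_weyl l)"
  obtain \<sigma> u where xe: "x = (\<sigma>, u)" by (cases x)
  have \<sigma>: "\<sigma> permutes {1..l}" using x by (simp add: xe ext_affine_weyl_def)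
  define y where "y = (inv_into UNIV \<sigma>, \<lambda>j\<in>{1..l}. - u (inv_into UNIV \<sigma> j))"
  have "y \<in> carrier (ext_affine_weyl l)"
    using permutes_inv[OF \<sigma>] by (auto simp: y_def ext_affine_weyl_def)
  moreover have "y \<otimes>\<^bsub>ext_affine_weyl l\<^esub> x = \<one>\<^bsub>ext_affine_weyl l\<^esub>"
    using permutes_inv_o(2)[OF \<sigma>] permutes_mem[OF \<sigma>[unfolded One_nat_def]] permutes_inverses(2)[OF \<sigma>]
    by (auto simp: y_def xe ext_affine_weyl_def fun_eq_iff restrict_def tuple_perm_def)
  ultimately show "\<exists>y\<in>carrier (ext_affine_weyl l).
      y \<otimes>\<^bsub>ext_affine_weyl l\<^esub> x = \<one>\<^bsub>ext_affine_weyl l\<^esub>" by blast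
qed

lemma weyl_act_closed:
  assumes "x \<in> multipartitions l \<times> multicharges l" "g \<in> carrier (ext_affine_weyl l)"
  shows "weyl_act e l x g \<in> multipartitions l \<times> multicharges l"
proof -
  obtain lam t \<sigma> u where x: "x = (lam, t)" and g: "g = (\<sigma>, u)" by (cases x; cases g)
  have "\<sigma> j \<in> {1..l}" if "j \<in> {1..l}" for j
    using assms(2) that permutes_in_image[of \<sigma> "{1..l}" j] by (simp add: g ext_affine_weyl_def)
  then show ?thesis
    using assms(1) unfolding x g
    by (simp add: multipartitions_def multicharges_def tuple_perm_def PiE_iff)
qed

lemma weyl_act_one:
  assumes "x \<in> multipartitions l \<times> multicharges l"
  shows "weyl_act e l x \<one>\<^bsub>ext_affine_weyl l\<^esub> = x"
  using assms
  by (cases x) (auto simp: multipartitions_def multicharges_def ext_affine_weyl_def tuple_perm_def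
      fun_eq_iff restrict_def PiE_def extensional_def)

lemma weyl_act_mult:
  assumes "g \<in> carrier (ext_affine_weyl l)" "h \<in> carrier (ext_affine_weyl l)"
  shows "weyl_act e l x (g \<otimes>\<^bsub>ext_affine_weyl l\<^esub> h) = weyl_act e l (weyl_act e l x g) h"
  using assms
  by (cases x; cases g; cases h)
    (auto simp: ext_affine_weyl_def tuple_perm_def fun_eq_iff restrict_def algebra_simps
      dest: permutes_mem)

lemma is_beta_set_iff: "is_beta_set B \<longleftrightarrow> (\<exists>m. \<forall>x\<in>B. x \<le> m) \<and> (\<exists>m. \<forall>x<m. x \<in> B)"
proof
  assume "is_beta_set B"
  then show "(\<exists>m. \<forall>x\<in>B. x \<le> m) \<and> (\<exists>m. \<forall>x<m. x \<in> B)"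
    unfolding is_beta_set_def by (metis ComplI not_less)
next
  assume "(\<exists>m. \<forall>x\<in>B. x \<le> m) \<and> (\<exists>m. \<forall>x<m. x \<in> B)"
  then obtain M m where M: "\<forall>x\<in>B. x \<le> M" and m: "\<forall>x<m. x \<in> B" by blast
  have fin: "finite (B \<inter> {m - 1..})" "finite (- B \<inter> {..M + 1})"
    by (rule finite_subset[of _ "{m - 1..M + 1}"], use M m in force, simp)+
  have ne: "m - 1 \<in> B \<inter> {m - 1..}" "M + 1 \<in> - B \<inter> {..M + 1}"
    using M m by auto
  have "\<forall>x\<in>B. x \<le> Max (B \<inter> {m - 1..})"
  proof
    fix x assume "x \<in> B"
    then show "x \<le> Max (B \<inter> {m - 1..})"
      using Max_ge[OF fin(1) ne(1)] Max_ge[OF fin(1), of x] by (cases "m - 1 \<le> x") auto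
  qed
  moreover have "Max (B \<inter> {m - 1..}) \<in> B"
    using Max_in[OF fin(1)] ne(1) by blast
  moreover have "\<forall>x\<in>- B. Min (- B \<inter> {..M + 1}) \<le> x"
  proof
    fix x assume "x \<in> - B"
    then show "Min (- B \<inter> {..M + 1}) \<le> x"
      using Min_le[OF fin(2) ne(2)] Min_le[OF fin(2), of x] by (cases "x \<le> M + 1") auto
  qed
  moreover have "Min (- B \<inter> {..M + 1}) \<in> - B"
    using Min_in[OF fin(2)] ne(2) by blast
  ultimately show "is_beta_set B" unfolding is_beta_set_def by blast
qed

lemma is_beta_set_beta:
  assumes "lam \<in> partitions"
  shows "is_beta_set (beta t lam)"
proof -
  obtain N where N: "\<And>a. a \<ge> N \<Longrightarrow> lam a = 0" and dec: "antimono lam"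
    using assms by (auto simp: partitions_def)
  have "\<forall>x\<in>beta t lam. x \<le> int (lam 0) + t"
  proof
    fix x assume "x \<in> beta t lam"
    then obtain a where "x = int (lam a) + t - int (Suc a)" unfolding beta_def by blast
    moreover have "lam a \<le> lam 0" using antimonoD[OF dec, of 0 a] by simp
    ultimately show "x \<le> int (lam 0) + t" by linarith
  qed
  moreover have "x \<in> beta t lam" if "x < t - int N" for x
  proof -
    have "x = int (lam (nat (t - x - 1))) + t - int (Suc (nat (t - x - 1)))"
      using N[of "nat (t - x - 1)"] that by simp
    then show ?thesis unfolding beta_def by blast
  qed
  ultimately show ?thesis unfolding is_beta_set_iff by blast
qed

lemma is_beta_set_runner:
  assumes "is_beta_set B" "i < e"
  shows "is_beta_set (runner e B i)"
proof -
  obtain M m where M: "\<And>x. x \<in> B \<Longrightarrow> x \<le> M" and m: "\<And>x. x < m \<Longrightarrow> x \<in> B"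
    using assms by (auto simp: is_beta_set_iff)
  have "a \<le> \<bar>M\<bar>" if "a \<in> runner e B i" for a
  proof (rule ccontr)
    assume a: "\<not> a \<le> \<bar>M\<bar>"
    then have "a * 1 \<le> a * int e" using assms(2) by (intro mult_left_mono) auto
    then show False using a M[of "a * int e + int i"] that by (auto simp: runner_def)
  qed
  moreover have "a \<in> runner e B i" if "a < - \<bar>m\<bar> - int e" for a
  proof -
    have "a * int e \<le> a * 1" using that assms(2) by (intro mult_left_mono_neg) auto
    then show ?thesis using that assms(2) by (auto simp: runner_def intro!: m)
  qed
  ultimately show ?thesis unfolding is_beta_set_iff by blast
qed

end

theory Submission
  imports Defs
begin

text \<open>Adding \<open>e u\<^sub>j\<close> to the \<open>j\<close>-th charge translates every runner of the \<open>j\<close>-th \<beta>-set by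
  \<open>u\<^sub>j\<close>, so all runners of the Uglov image change charge by the same amount, and
  \<open>beta_inv\<close> forgets this common translation of the core.

  For the weight, let \<open>c\<^sub>j\<^sub>b\<close> be the charge of runner \<open>b\<close> of the \<open>j\<close>-th \<beta>-set. Computing the size
  of runner \<open>b\<close> of the Uglov image as a truncated sum of positions gives, up to a term invariant under
  the action, the sum over \<open>i < j\<close> of \<open>d (d - 1) / 2\<close> with \<open>d = c\<^sub>j\<^sub>b - c\<^sub>i\<^sub>b\<close>. Summed over \<open>b\<close>, the weight
  times \<open>2e\<close> is an invariant plus the sum over \<open>i < j\<close> of \<open>g (t\<^sub>j - t\<^sub>i)\<close>, where \<open>g d = d (d - e)\<close>. Now
  \<open>g (d mod e) \<le> g d\<close>, with equality iff \<open>0 \<le> d \<le> e\<close>, and \<open>g (d mod e)\<close> is symmetric in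
  \<open>d \<mapsto> - d\<close>, so the sum of the residual values is an invariant of the orbit. Sorting the residues of
  the charges shows that this lower bound is attained.\<close>

section \<open>Charge and size of truncated \<beta>-sets\<close>

text \<open>A cut point below which \<open>B\<close> is full: everything about \<open>B\<close> is
  then read off the finite set \<open>B \<inter> {m..}\<close>. Any sufficiently low
  \<open>m\<close> works, so a finite family of beta-sets can share one cut.\<close>

definition truncates :: "int \<Rightarrow> int set \<Rightarrow> bool" where
  "truncates m B \<longleftrightarrow> {..<m} \<subseteq> B \<and> finite (B \<inter> {m..})"

lemma eventually_truncates:
  assumes "is_beta_set B"
  shows "eventually (\<lambda>m. truncates m B) at_bot"
proof -
  obtain M k where M: "\<And>x. x \<in> B \<Longrightarrow> x \<le> M" and k: "\<And>x. x < k \<Longrightarrow> x \<in> B"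
    using assms by (auto simp: is_beta_set_iff)
  have "truncates m B" if "m \<le> k" for m
  proof -
    have "finite (B \<inter> {m..})"
      by (rule finite_subset[of _ "{m..M}"]) (use M in auto)
    then show ?thesis using k that by (auto simp: truncates_def)
  qed
  then show ?thesis unfolding eventually_at_bot_linorder by blast
qed

text \<open>Moving the cut from 0 to \<open>m\<close> leaves the count unchanged. For
  \<open>m \<ge> 0\<close> the positions in \<open>{0..<m}\<close> all belong to \<open>B\<close>;
  for \<open>m < 0\<close> each position in \<open>{m..<0}\<close> is either a member of
  \<open>B\<close> or a gap counted negatively by \<open>charge\<close>.\<close>

lemma charge_truncates:
  assumes "truncates m B"
  shows "charge B = int (card (B \<inter> {m..})) + m"
proof (cases "m \<ge> 0")
  case True
  have eq: "B \<inter> {0..} = (B \<inter> {m..}) \<union> {0..<m}" and neg: "{..<0} - B = {}"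
    using assms True by (auto simp: truncates_def)
  have "card (B \<inter> {0..}) = card (B \<inter> {m..}) + card {0..<m}"
    unfolding eq using assms by (intro card_Un_disjoint) (auto simp: truncates_def)
  then show ?thesis using True unfolding charge_def neg by simp
next
  case False
  have fin: "finite (B \<inter> {m..<0})" "finite ({m..<0} - B)" "finite (B \<inter> {0..})"
    using False assms by (auto simp: truncates_def intro: finite_subset[of _ "B \<inter> {m..}"])
  have "B \<inter> {m..} = (B \<inter> {m..<0}) \<union> (B \<inter> {0..})" and neg: "{..<0} - B = {m..<0} - B"
    using assms False by (force simp: truncates_def)+
  then have "card (B \<inter> {m..}) = card (B \<inter> {m..<0}) + card (B \<inter> {0..})"
    using fin by (simp only:) (intro card_Un_disjoint, auto)
  moreover have "card {m..<0} = card (B \<inter> {m..<0}) + card ({m..<0} - B)"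
  proof (subst card_Un_disjoint[symmetric])
    show "card {m..<0} = card (B \<inter> {m..<0} \<union> ({m..<0} - B))" by (rule arg_cong[where f = card]) auto
  qed (use fin in auto)
  ultimately show ?thesis using False unfolding charge_def neg by simp
qed

section \<open>Translations of beta-sets\<close>

lemma mem_shift_iff: "x \<in> (+) k ` B \<longleftrightarrow> x - k \<in> B" for k :: int
  by (auto intro!: image_eqI[of _ _ "x - k"])

lemma truncates_shift:
  assumes "truncates m B"
  shows "truncates (m + k) ((+) k ` B)"
    and "((+) k ` B) \<inter> {m + k..} = (+) k ` (B \<inter> {m..})"
proof -
  show eq: "((+) k ` B) \<inter> {m + k..} = (+) k ` (B \<inter> {m..})"
    unfolding set_eq_iff Int_iff mem_shift_iff by auto
  have "{..<m + k} \<subseteq> (+) k ` B"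
    using assms unfolding truncates_def subset_iff mem_shift_iff by auto
  then show "truncates (m + k) ((+) k ` B)"
    using assms unfolding truncates_def eq by simp
qed

lemma charge_shift:
  assumes "is_beta_set B"
  shows "charge ((+) k ` B) = charge B + k"
proof -
  obtain m where m: "truncates m B"
    using eventually_truncates[OF assms] by (metis eventually_at_bot_linorder order_refl)
  show ?thesis
    using charge_truncates[OF m] charge_truncates[OF truncates_shift(1)[OF m, of k]]
    unfolding truncates_shift(2)[OF m] by (simp add: card_image)
qed

lemma beta_eq_range: "beta t lam = range (\<lambda>a. int (lam a) + t - int (Suc a))"
  by (auto simp: beta_def)

lemma beta_shift: "beta (t + k) lam = (+) k ` beta t lam"
proof -
  have "int (lam a) + (t + k) - int (Suc a) = k + (int (lam a) + t - int (Suc a))" for a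
    by simp
  then show ?thesis unfolding beta_eq_range image_image by (simp only:)
qed

text \<open>The charge and \<open>beta\<close> undergo the same translation by \<open>k\<close>, so
  both definite descriptions use the same predicate on partitions.\<close>

lemma beta_inv_shift:
  assumes "is_beta_set B"
  shows "beta_inv ((+) k ` B) = beta_inv B"
  unfolding beta_inv_def charge_shift[OF assms] beta_shift by (simp add: inj_image_eq_iff)

lemma runner_shift: "runner e ((+) (int e * k) ` B) i = (+) k ` runner e B i"
  unfolding runner_def set_eq_iff mem_shift_iff by (simp add: algebra_simps)

lemma charge_beta:
  assumes "lam \<in> partitions"
  shows "charge (beta t lam) = t"
proof -
  obtain N where N: "\<And>a. a \<ge> N \<Longrightarrow> lam a = 0" and dec: "antimono lam"
    using assms by (auto simp: partitions_def)
  define f where "f a = int (lam a) + t - int (Suc a)" for a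
  have fdec: "f b < f a" if "a < b" for a b
    using antimonoD[OF dec, of a b] that by (simp add: f_def)
  have inj: "inj f"
    by (rule injI) (metis fdec less_irrefl linorder_less_linear)
  have B: "beta t lam = range f" by (simp add: beta_eq_range f_def[abs_def])
  \<comment> \<open>The first \<open>N\<close> positions are exactly those at or above
    \<open>t - N\<close>, because later parts are zero; the charge is therefore
    \<open>N + (t - N)\<close>.\<close>
  have X: "range f \<inter> {t - int N..} = f ` {..<N}"
  proof -
    have "f a \<ge> t - int N \<longleftrightarrow> a < N" for a
      using N[of a] by (cases "a < N") (auto simp: f_def)
    then show ?thesis by auto
  qed
  have "x \<in> range f" if "x < t - int N" for x
    using N[of "nat (t - x - 1)"] that by (intro range_eqI[of _ _ "nat (t - x - 1)"]) (simp add: f_def)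
  then have "truncates (t - int N) (range f)" by (auto simp: truncates_def X)
  from charge_truncates[OF this] show ?thesis
    unfolding B X by (simp add: card_image inj_on_subset[OF inj])
qed

section \<open>Splitting a beta-set into its runners\<close>

lemma truncates_runner:
  assumes "n > 0" and tr: "\<And>i. i < n \<Longrightarrow> truncates m (runner n B i)"
  shows "truncates (int n * m) B"
    and "B \<inter> {int n * m..} = (\<Union>i<n. (\<lambda>a. a * int n + int i) ` (runner n B i \<inter> {m..}))"
proof -
  have dec: "\<exists>i<n. \<exists>a. x = a * int n + int i" for x
    using assms(1) by (intro exI[of _ "nat (x mod int n)"] conjI exI[of _ "x div int n"])
      (auto simp: nat_less_iff)
  have le: "int n * m \<le> a * int n + int i \<longleftrightarrow> m \<le> a" if "i < n" for a i
  proof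
    assume "int n * m \<le> a * int n + int i"
    then have "int n * m < int n * (a + 1)" using that by (simp add: algebra_simps)
    then show "m \<le> a" using assms(1) by (simp add: mult_less_cancel_left)
  next
    assume "m \<le> a"
    then have "int n * m \<le> int n * a" by (intro mult_left_mono) auto
    then show "int n * m \<le> a * int n + int i" by (simp add: mult.commute)
  qed
  show eq: "B \<inter> {int n * m..} = (\<Union>i<n. (\<lambda>a. a * int n + int i) ` (runner n B i \<inter> {m..}))"
  proof (intro subset_antisym subsetI)
    fix x assume x: "x \<in> B \<inter> {int n * m..}"
    obtain i a where "i < n" and xe: "x = a * int n + int i" using dec by blast
    then show "x \<in> (\<Union>i<n. (\<lambda>a. a * int n + int i) ` (runner n B i \<inter> {m..}))"
      using x le[of i a] by (auto simp: runner_def)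
  qed (auto simp: runner_def le)
  have "x \<in> B" if x: "x < int n * m" for x
  proof -
    obtain i a where i: "i < n" and xe: "x = a * int n + int i" using dec by blast
    have "a < m" using le[OF i, of a] x xe by linarith
    then have "a \<in> runner n B i" using tr[OF i] by (auto simp: truncates_def)
    then show "x \<in> B" by (simp add: runner_def xe)
  qed
  then show "truncates (int n * m) B"
    using tr by (auto simp: truncates_def eq)
qed

text \<open>Residues mod \<open>n\<close> separate the runners, and a common cut \<open>m\<close> on
  the runners is the cut \<open>n * m\<close> on \<open>B\<close>. Charge and size are both obtained
  from this, with \<open>f\<close> constant or linear.\<close>

lemma sum_runner:
  assumes "n > 0" and "\<And>i. i < n \<Longrightarrow> truncates m (runner n B i)"
  shows "sum f (B \<inter> {int n * m..}) = (\<Sum>i<n. \<Sum>a\<in>runner n B i \<inter> {m..}. f (a * int n + int i))"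
proof -
  have inj: "inj_on (\<lambda>a. a * int n + int i) A" for i A
    using assms(1) by (auto intro: inj_onI)
  have disj: "(\<lambda>a. a * int n + int i) ` A \<inter> (\<lambda>a. a * int n + int j) ` A' = {}"
    if "i < n" "j < n" "i \<noteq> j" for i j and A A'
  proof -
    have "(a * int n + int i) mod int n \<noteq> (a' * int n + int j) mod int n" for a a'
      using that by simp
    then show ?thesis by (metis (no_types, lifting) disjoint_iff imageE)
  qed
  have "sum f (B \<inter> {int n * m..}) =
      (\<Sum>i<n. sum f ((\<lambda>a. a * int n + int i) ` (runner n B i \<inter> {m..})))"
    by (subst truncates_runner(2)[OF assms], assumption)
      (intro sum.UNION_disjoint ballI impI disj, use assms(2) in \<open>auto simp: truncates_def\<close>)
  also have "\<dots> = (\<Sum>i<n. \<Sum>a\<in>runner n B i \<inter> {m..}. f (a * int n + int i))"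
    by (simp add: sum.reindex[OF inj])
  finally show ?thesis .
qed

lemma charge_runner:
  assumes "n > 0" and "\<And>i. i < n \<Longrightarrow> truncates m (runner n B i)"
  shows "charge B = (\<Sum>i<n. charge (runner n B i))"
proof -
  have "int (card (B \<inter> {int n * m..})) = (\<Sum>x\<in>B \<inter> {int n * m..}. 1)" by simp
  also have "\<dots> = (\<Sum>i<n. \<Sum>a\<in>runner n B i \<inter> {m..}. 1)" by (rule sum_runner[OF assms])
  also have "\<dots> = (\<Sum>i<n. charge (runner n B i) - m)"
    by (simp add: charge_truncates[OF assms(2)])
  finally show ?thesis
    by (simp add: charge_truncates[OF truncates_runner(1)[OF assms]] sum_subtractf)
qed

section \<open>The size of the partition encoded by a beta-set\<close>

lemma strict_antimono_enum_unique:
  fixes b b' :: "nat \<Rightarrow> int"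
  assumes b: "\<And>n. b (Suc n) < b n" and b': "\<And>n. b' (Suc n) < b' n" and "range b = range b'"
  shows "b = b'"
proof -
  have le: "c n \<le> c' n" if dec: "\<And>n. c (Suc n) < c n" and dec': "\<And>n. c' (Suc n) < c' n"
    and sub: "range c \<subseteq> range c'" and eq: "\<And>k. k < n \<Longrightarrow> c k = c' k" for c c' :: "nat \<Rightarrow> int" and n
  proof -
    obtain p where p: "c n = c' p" using sub by blast
    have "c n < c k" if "k < n" for k
      using lift_Suc_mono_less[of "\<lambda>n. - c n" k n] dec that by simp
    \<comment> \<open>If \<open>p < n\<close>, then \<open>c n = c' p = c p\<close>, contradicting
      that \<open>c\<close> is strictly decreasing.\<close>
    then have "n \<le> p" using eq[of p] p by (metis less_irrefl not_less)
    then show ?thesis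
      unfolding p using lift_Suc_mono_le[of "\<lambda>n. - c' n" n p] dec' by (simp add: less_imp_le)
  qed
  have "b n = b' n" for n
  proof (induction n rule: less_induct)
    case (less n)
    have "b n \<le> b' n" using assms less by (intro le) auto
    moreover have "b' n \<le> b n" using assms less by (intro le) auto
    ultimately show ?case by simp
  qed
  then show ?thesis by blast
qed

text \<open>The size of the partition with beta-set \<open>B\<close>, written as the inner sum of
  \<open>wt\<close>; thus \<open>wt e B\<close> is the sum of the sizes of the runners.\<close>

definition beta_size :: "int set \<Rightarrow> int" where
  "beta_size B = Sum_any (\<lambda>a. desc_enum B a - charge B + int (Suc a))"

lemma desc_enum_eqI:
  assumes "\<And>n. b (Suc n) < b n" and "range b = B"
  shows "desc_enum B = b"
  unfolding desc_enum_def using assms strict_antimono_enum_unique[of _ b] by (intro the_equality) auto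

text \<open>The size is the sum of the positions above the cut minus the sum over
  \<open>m, ..., charge B - 1\<close>, the positions of the empty partition of the same charge.
  Doubling avoids halves in the triangular numbers.\<close>

lemma beta_size_truncates:
  assumes "truncates m B"
  shows "2 * beta_size B =
    2 * \<Sum>(B \<inter> {m..}) - charge B * (charge B - 1) + m * (m - 1)"
proof -
  define X where "X = B \<inter> {m..}"
  have fin: "finite X" and low: "{..<m} \<subseteq> B" using assms by (auto simp: truncates_def X_def)
  define n where "n = card X"
  define xs where "xs = rev (sorted_list_of_set X)"
  have len: "length xs = n" and set: "set xs = X" and dist: "distinct xs"
    using fin by (auto simp: xs_def n_def)
  have dec: "xs ! Suc a < xs ! a" if "Suc a < n" for a
  proof -
    have "sorted_wrt (>) xs" using fin by (simp add: xs_def sorted_wrt_rev)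
    then show ?thesis using that len by (auto simp: sorted_wrt_iff_nth_less)
  qed
  \<comment> \<open>The descending enumeration: first the elements above the cut, then
    \<open>m - 1, m - 2, ...\<close> without gaps.\<close>
  define b where "b a = (if a < n then xs ! a else m - 1 - int (a - n))" for a
  have "b (Suc a) < b a" for a
  proof -
    have "xs ! a \<ge> m" if "a < n"
      using nth_mem[of a xs] that len set by (auto simp: X_def)
    then show ?thesis using dec[of a] by (auto simp: b_def)
  qed
  moreover have "range b = B"
  proof -
    have "range b = b ` {..<n} \<union> b ` {n..}" by (auto simp flip: image_Un simp: ivl_disj_un)
    also have "b ` {..<n} = X"
      unfolding set[symmetric] set_conv_nth len by (auto simp: b_def)
    also have "b ` {n..} = {..<m}"
    proof (intro subset_antisym subsetI)
      fix x assume "x \<in> {..<m}"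
      then show "x \<in> b ` {n..}"
        by (intro image_eqI[of _ _ "n + nat (m - 1 - x)"]) (auto simp: b_def)
    qed (auto simp: b_def)
    finally show ?thesis using low by (auto simp: X_def)
  qed
  ultimately have enum: "desc_enum B = b" by (rule desc_enum_eqI)
  have s: "charge B = int n + m" using charge_truncates[OF assms] by (simp add: n_def X_def)
  have "beta_size B = (\<Sum>a<n. b a - charge B + int (Suc a))"
    unfolding beta_size_def enum
    \<comment> \<open>From index \<open>n\<close> on the summand is zero, since
      \<open>charge B = n + m\<close>.\<close>
    by (rule Sum_any.expand_superset) (auto simp: b_def s not_less)
  also have "\<dots> = (\<Sum>a<n. b a) - int n * charge B + (\<Sum>a<n. int (Suc a))"
    by (simp add: sum.distrib sum_subtractf)
  also have "(\<Sum>a<n. b a) = sum_list xs"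
    by (simp add: sum_list_sum_nth len b_def atLeast0LessThan)
  also have "\<dots> = \<Sum>X" using sum_list_distinct_conv_sum_set[OF dist, of id] by (simp add: set)
  finally have "2 * beta_size B = 2 * \<Sum>X - 2 * int n * charge B + 2 * (\<Sum>a<n. int (Suc a))"
    by simp
  also have "2 * (\<Sum>a<n. int (Suc a)) = int n * (int n + 1)"
    by (induction n) (auto simp: algebra_simps)
  finally show ?thesis by (simp add: s X_def algebra_simps)
qed

text \<open>A translation by \<open>k\<close> adds \<open>(charge B - m) * k\<close> to the position
  sum, which compensates the change in the two quadratic terms.\<close>

lemma beta_size_shift:
  assumes "is_beta_set B"
  shows "beta_size ((+) k ` B) = beta_size B"
proof -
  obtain m where m: "truncates m B"
    using eventually_truncates[OF assms] by (metis eventually_at_bot_linorder order_refl)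
  have "\<Sum>(((+) k ` B) \<inter> {m + k..}) = \<Sum>(B \<inter> {m..}) + (charge B - m) * k"
    unfolding truncates_shift(2)[OF m] using charge_truncates[OF m]
    by (subst sum.reindex) (simp_all add: sum.distrib)
  then have "2 * beta_size ((+) k ` B) = 2 * beta_size B"
    unfolding beta_size_truncates[OF m] beta_size_truncates[OF truncates_shift(1)[OF m, of k]]
      charge_shift[OF assms] by (simp only:) (simp add: algebra_simps)
  then show ?thesis by simp
qed

text \<open>The core-and-quotient formula: \<open>n\<close> times the sizes of the runners, plus a
  quadratic function of their charges that gives the size of the core. It results from evaluating
  one position sum both on \<open>B\<close> and runner by runner.\<close>

lemma beta_size_runner:
  assumes "n > 0" and tr: "\<And>i. i < n \<Longrightarrow> truncates m (runner n B i)"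
  shows "2 * beta_size B = (\<Sum>i<n. 2 * int n * beta_size (runner n B i) +
      int n * (charge (runner n B i) * (charge (runner n B i) - 1)) + 2 * int i * charge (runner n B i))
    - charge B * (charge B - 1)"
proof -
  let ?R = "runner n B"
  have gauss: "2 * (\<Sum>i<n. int i) = int n * (int n - 1)"
    by (induction n) (auto simp: algebra_simps)
  have "2 * \<Sum>(B \<inter> {int n * m..}) =
      (\<Sum>i<n. \<Sum>a\<in>?R i \<inter> {m..}. 2 * (a * int n + int i))"
    unfolding sum_distrib_left by (rule sum_runner[OF assms])
  also have "\<dots> =
      (\<Sum>i<n. 2 * int n * \<Sum>(?R i \<inter> {m..}) + 2 * int i * (charge (?R i) - m))"
  proof (intro sum.cong refl)
    fix i assume "i \<in> {..<n}"
    then have "charge (?R i) - m = int (card (?R i \<inter> {m..}))" by (simp add: charge_truncates[OF tr])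
    moreover have "(\<Sum>a\<in>A. 2 * (a * int n + int i)) = 2 * int n * \<Sum>A + 2 * int i * int (card A)"
      for A :: "int set"
      by (simp add: sum.distrib distrib_left sum_distrib_left mult_ac)
    ultimately show "(\<Sum>a\<in>?R i \<inter> {m..}. 2 * (a * int n + int i)) =
        2 * int n * \<Sum>(?R i \<inter> {m..}) + 2 * int i * (charge (?R i) - m)" by simp
  qed
  also have "\<dots> = (\<Sum>i<n. (2 * int n * beta_size (?R i) +
      int n * (charge (?R i) * (charge (?R i) - 1)) + 2 * int i * charge (?R i))
      - (int n * (m * (m - 1)) + 2 * m * int i))"
  proof (intro sum.cong refl)
    fix i assume "i \<in> {..<n}"
    then have "2 * \<Sum>(?R i \<inter> {m..}) =
        2 * beta_size (?R i) + charge (?R i) * (charge (?R i) - 1) - m * (m - 1)"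
      using beta_size_truncates[OF tr, of i] by simp
    then have "int n * (2 * \<Sum>(?R i \<inter> {m..})) = int n *
        (2 * beta_size (?R i) + charge (?R i) * (charge (?R i) - 1) - m * (m - 1))" by simp
    then show "2 * int n * \<Sum>(?R i \<inter> {m..}) + 2 * int i * (charge (?R i) - m) =
        (2 * int n * beta_size (?R i) +
      int n * (charge (?R i) * (charge (?R i) - 1)) + 2 * int i * charge (?R i))
      - (int n * (m * (m - 1)) + 2 * m * int i)"
      by (simp add: algebra_simps)
  qed
  also have "\<dots> = (\<Sum>i<n. 2 * int n * beta_size (?R i) +
      int n * (charge (?R i) * (charge (?R i) - 1)) + 2 * int i * charge (?R i))
      - (int n * (int n * (m * (m - 1))) + m * (2 * (\<Sum>i<n. int i)))"
    by (simp add: sum_subtractf sum.distrib sum_distrib_left mult.assoc mult.left_commute[of m])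
  finally have "2 * \<Sum>(B \<inter> {int n * m..}) = \<dots>" .
  moreover have "truncates (int n * m) B" by (rule truncates_runner(1)[OF assms])
  note beta_size_truncates[OF this]
  \<comment> \<open>The terms in the auxiliary cut \<open>m\<close> from both evaluations agree, so
    \<open>m\<close> drops out.\<close>
  moreover have "int n * m * (int n * m - 1) =
      int n * (int n * (m * (m - 1))) + m * (int n * (int n - 1))" by (simp add: algebra_simps)
  ultimately show ?thesis unfolding gauss by linarith
qed

section \<open>The energy of a multicharge\<close>

text \<open>The squares give \<open>l\<close> times the sum of squares minus the square of the sum.
  In the linear part, \<open>s j\<close> occurs with sign plus in \<open>l - j\<close> pairs and
  minus in \<open>j - 1\<close> pairs, which is the coefficient
  \<open>l + 1 - 2 * j\<close>.\<close>

lemma sum_pairs_charges: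
  fixes s :: "nat \<Rightarrow> int"
  shows "int l * (\<Sum>j=1..l. s j * s j) + (int l + 1) * (\<Sum>j=1..l. s j) - 2 * (\<Sum>j=1..l. int j * s j)
      - (\<Sum>j=1..l. s j) * (\<Sum>j=1..l. s j) =
    (\<Sum>j=1..l. \<Sum>i=1..<j. (s j - s i) * (s j - s i - 1))"
proof (induction l)
  case (Suc l)
  have "(\<Sum>i=1..<Suc l. (s (Suc l) - s i) * (s (Suc l) - s i - 1)) =
      int l * (s (Suc l) * s (Suc l) - s (Suc l)) + (\<Sum>j=1..l. s j * s j)
      - 2 * s (Suc l) * (\<Sum>j=1..l. s j) + (\<Sum>j=1..l. s j)"
    by (simp add: algebra_simps sum.distrib sum_subtractf sum_distrib_left atLeastLessThanSuc_atLeastAtMost)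
  then show ?case using Suc.IH by (simp add: algebra_simps)
qed simp

lemma sum_square_eq_pairs:
  fixes F :: "nat \<Rightarrow> nat \<Rightarrow> int"
  assumes "\<And>i j. F i j = F j i"
  shows "(\<Sum>j=1..l. \<Sum>i=1..l. F i j) = 2 * (\<Sum>j=1..l. \<Sum>i=1..<j. F i j) + (\<Sum>j=1..l. F j j)"
proof (induction l)
  case (Suc l)
  have "(\<Sum>i=1..l. F (Suc l) i) = (\<Sum>i=1..l. F i (Suc l))"
    by (intro sum.cong) (auto simp: assms)
  then show ?case
    using Suc.IH by (simp add: sum.distrib atLeastLessThanSuc_atLeastAtMost)
qed simp

text \<open>A permutation need not preserve the order of a pair, but it preserves the full square of
  indices and its diagonal; symmetry of \<open>F\<close> transfers this to the pairs
  \<open>i < j\<close>.\<close>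

lemma sum_pairs_permute:
  fixes F :: "nat \<Rightarrow> nat \<Rightarrow> int"
  assumes sym: "\<And>i j. F i j = F j i" and \<sigma>: "\<sigma> permutes {1..l}"
  shows "(\<Sum>j=1..l. \<Sum>i=1..<j. F (\<sigma> i) (\<sigma> j)) = (\<Sum>j=1..l. \<Sum>i=1..<j. F i j)"
proof -
  have perm: "(\<Sum>j=1..l. f (\<sigma> j)) = (\<Sum>j=1..l. f j)" for f :: "nat \<Rightarrow> int"
    using sum.permute[OF \<sigma>, of f] by (simp add: o_def)
  have "2 * (\<Sum>j=1..l. \<Sum>i=1..<j. F (\<sigma> i) (\<sigma> j)) =
      (\<Sum>j=1..l. \<Sum>i=1..l. F (\<sigma> i) (\<sigma> j)) - (\<Sum>j=1..l. F (\<sigma> j) (\<sigma> j))"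
    using sum_square_eq_pairs[of "\<lambda>i j. F (\<sigma> i) (\<sigma> j)" l] sym by simp
  also have "\<dots> = (\<Sum>j=1..l. \<Sum>i=1..l. F i j) - (\<Sum>j=1..l. F j j)"
    unfolding perm[of "\<lambda>j. F j j"] perm[of "\<lambda>i. F i _"] perm[of "\<lambda>j. \<Sum>i=1..l. F i j"] ..
  also have "\<dots> = 2 * (\<Sum>j=1..l. \<Sum>i=1..<j. F i j)"
    using sum_square_eq_pairs[of F l] sym by simp
  finally show ?thesis by simp
qed

section \<open>Comparison of the energy with its residual value\<close>

lemma mod_energy_le:
  fixes d e :: int
  assumes "e > 0"
  shows "(d mod e) * (d mod e - e) \<le> d * (d - e)"
    and "(d mod e) * (d mod e - e) = d * (d - e) \<longleftrightarrow> 0 \<le> d \<and> d \<le> e"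
proof -
  define q r where "q = d div e" and "r = d mod e"
  have d: "d = e * q + r" and r: "0 \<le> r" "r < e" using assms by (auto simp: q_def r_def)
  have diff: "d * (d - e) - r * (r - e) = e * (q * (e * (q - 1) + 2 * r))"
    unfolding d by (simp add: algebra_simps)
  \<comment> \<open>The sign of \<open>diff\<close> depends on \<open>q\<close>. It vanishes for
    \<open>q = 0\<close>; for \<open>q = 1\<close> it is \<open>2 * e * r\<close>, zero only at
    \<open>d = e\<close>. Otherwise \<open>q\<close> and \<open>e * (q - 1) + 2 * r\<close> are
    nonzero with equal signs, so it is positive.\<close>
  consider "q = 0" | "q = 1" | "q \<ge> 2" | "q \<le> -1" by linarith
  then have "(0 \<le> d * (d - e) - r * (r - e)) \<and> (d * (d - e) = r * (r - e) \<longleftrightarrow> 0 \<le> d \<and> d \<le> e)"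
  proof cases
    case 1
    then show ?thesis using r by (simp add: d)
  next
    case 2
    then show ?thesis using r assms diff unfolding d by auto
  next
    case 3
    then have "e * 1 \<le> e * (q - 1)" using assms by (intro mult_left_mono) auto
    then have "0 < e * (q - 1) + 2 * r" using assms r by linarith
    then have "0 < q * (e * (q - 1) + 2 * r)" using 3 by (intro mult_pos_pos) auto
    then have "0 < e * (q * (e * (q - 1) + 2 * r))" using assms by (rule mult_pos_pos[rotated])
    moreover have "d > e" using \<open>e * 1 \<le> e * (q - 1)\<close> r assms unfolding d right_diff_distrib by linarith
    ultimately show ?thesis using diff by auto
  next
    case 4
    then have "e * (q - 1) \<le> e * (- 2)" "e * q \<le> e * (- 1)"
      using assms by (intro mult_left_mono; simp)+
    then have "e * (q - 1) + 2 * r < 0" using r by linarith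
    then have "0 < q * (e * (q - 1) + 2 * r)" using 4 by (intro mult_neg_neg) auto
    then have "0 < e * (q * (e * (q - 1) + 2 * r))" using assms by (rule mult_pos_pos[rotated])
    moreover have "d < 0" using \<open>e * q \<le> e * (- 1)\<close> r assms by (simp add: d)
    ultimately show ?thesis using diff by auto
  qed
  then show "(d mod e) * (d mod e - e) \<le> d * (d - e)"
    and "(d mod e) * (d mod e - e) = d * (d - e) \<longleftrightarrow> 0 \<le> d \<and> d \<le> e"
    by (auto simp: r_def)
qed

text \<open>Negation replaces a nonzero residue \<open>r\<close> by \<open>e - r\<close>, and
  \<open>r * (r - e)\<close> is unchanged by that. The symmetry is what
  \<open>sum_pairs_permute\<close> requires.\<close>

lemma mod_energy_sym:
  fixes x y e :: int
  shows "((y - x) mod e) * ((y - x) mod e - e) = ((x - y) mod e) * ((x - y) mod e - e)"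
proof -
  have "x - y = - (y - x)" by simp
  then show ?thesis
    by (simp only: zmod_zminus1_eq_if) (simp add: algebra_simps mod_eq_0_iff_dvd)
qed

text \<open>The closed fundamental alcove of the affine Weyl group, scaled by
  \<open>e\<close>.\<close>

definition alcove :: "nat \<Rightarrow> nat \<Rightarrow> (nat \<Rightarrow> int) \<Rightarrow> bool" where
  "alcove e l v \<longleftrightarrow> (\<forall>j\<in>{1..<l}. v j \<le> v (Suc j)) \<and> v l \<le> v 1 + int e"

text \<open>The chain of inequalities traps every difference with \<open>i < j\<close> between 0 and
  \<open>v l - v 1\<close>. The pairwise form matches the equality case of
  \<open>mod_energy_le\<close> term by term.\<close>

lemma alcove_iff:
  "alcove e l v \<longleftrightarrow> (\<forall>j\<in>{1..l}. \<forall>i\<in>{1..<j}. 0 \<le> v j - v i \<and> v j - v i \<le> int e)" if "l \<ge> 1"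
proof
  assume v: "alcove e l v"
  have mono: "v i \<le> v j" if "1 \<le> i" "i \<le> j" "j \<le> l" for i j
    using that(2,3)
  proof (induction j rule: dec_induct)
    case (step n)
    moreover have "v n \<le> v (Suc n)" using v step that(1) by (simp add: alcove_def)
    ultimately show ?case by simp
  qed simp
  show "\<forall>j\<in>{1..l}. \<forall>i\<in>{1..<j}. 0 \<le> v j - v i \<and> v j - v i \<le> int e"
  proof (intro ballI)
    fix i j assume "j \<in> {1..l}" "i \<in> {1..<j}"
    then show "0 \<le> v j - v i \<and> v j - v i \<le> int e"
      using mono[of i j] mono[of 1 i] mono[of j l] v by (auto simp: alcove_def)
  qed
next
  assume v: "\<forall>j\<in>{1..l}. \<forall>i\<in>{1..<j}. 0 \<le> v j - v i \<and> v j - v i \<le> int e"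
  have "v j \<le> v (Suc j)" if "j \<in> {1..<l}" for j
    using v[rule_format, of "Suc j" j] that by auto
  moreover have "v l \<le> v 1 + int e"
    using v[rule_format, of l 1] that by (cases "l = 1") auto
  ultimately show "alcove e l v" by (auto simp: alcove_def)
qed

definition energy :: "nat \<Rightarrow> nat \<Rightarrow> (nat \<Rightarrow> int) \<Rightarrow> int" where
  "energy e l v = (\<Sum>j=1..l. \<Sum>i=1..<j. (v j - v i) * (v j - v i - int e))"

definition residue_energy :: "nat \<Rightarrow> nat \<Rightarrow> (nat \<Rightarrow> int) \<Rightarrow> int" where
  "residue_energy e l v =
    (\<Sum>j=1..l. \<Sum>i=1..<j. ((v j - v i) mod int e) * ((v j - v i) mod int e - int e))"

lemma residue_energy_le_energy:
  assumes "e > 0"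
  shows "residue_energy e l v \<le> energy e l v"
  unfolding residue_energy_def energy_def using assms by (intro sum_mono mod_energy_le) simp

lemma residue_energy_eq_energy_iff:
  assumes "e > 0" "l \<ge> 1"
  shows "residue_energy e l v = energy e l v \<longleftrightarrow> alcove e l v"
proof -
  let ?r = "\<lambda>i j. ((v j - v i) mod int e) * ((v j - v i) mod int e - int e)"
  let ?g = "\<lambda>i j. (v j - v i) * (v j - v i - int e)"
  have e: "int e > 0" using assms by simp
  have "residue_energy e l v = energy e l v \<longleftrightarrow> (\<Sum>j=1..l. \<Sum>i=1..<j. ?g i j - ?r i j) = 0"
    unfolding residue_energy_def energy_def by (auto simp: sum_subtractf)
  also have "\<dots> \<longleftrightarrow> (\<forall>j\<in>{1..l}. (\<Sum>i=1..<j. ?g i j - ?r i j) = 0)"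
    by (intro sum_nonneg_eq_0_iff sum_nonneg) (simp_all add: mod_energy_le(1)[OF e])
  also have "\<dots> \<longleftrightarrow> (\<forall>j\<in>{1..l}. \<forall>i\<in>{1..<j}. ?g i j - ?r i j = 0)"
    by (intro ball_cong refl sum_nonneg_eq_0_iff) (simp_all add: mod_energy_le(1)[OF e])
  also have "\<dots> \<longleftrightarrow> alcove e l v"
    unfolding alcove_iff[OF assms(2)] using mod_energy_le(2)[OF e] by (intro ball_cong refl) (metis eq_iff_diff_eq_0)
  finally show ?thesis .
qed

text \<open>Multiples of \<open>e\<close> vanish from the residues of the differences, so only the
  permutation of the pairs remains.\<close>

lemma residue_energy_orbit:
  assumes "\<sigma> permutes {1..l}" and v: "\<And>j. j \<in> {1..l} \<Longrightarrow> v j = t (\<sigma> j) + int e * u j"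
  shows "residue_energy e l v = residue_energy e l t"
proof -
  let ?r = "\<lambda>i j. ((t j - t i) mod int e) * ((t j - t i) mod int e - int e)"
  have "(v j - v i) mod int e = (t (\<sigma> j) - t (\<sigma> i)) mod int e" if "j \<in> {1..l}" "i \<in> {1..<j}" for i j
  proof -
    have "v j - v i = t (\<sigma> j) - t (\<sigma> i) + int e * (u j - u i)"
      using v[of j] v[of i] that by (simp add: algebra_simps)
    then show ?thesis by simp
  qed
  then have "residue_energy e l v = (\<Sum>j=1..l. \<Sum>i=1..<j. ?r (\<sigma> i) (\<sigma> j))"
    unfolding residue_energy_def by (intro sum.cong refl) simp
  also have "\<dots> = residue_energy e l t"
    unfolding residue_energy_def by (rule sum_pairs_permute[OF mod_energy_sym assms(1)])
  finally show ?thesis .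
qed

section \<open>Reaching the alcove within an orbit\<close>

lemma ex_sorting_permutation:
  fixes f :: "nat \<Rightarrow> 'a::linorder"
  shows "\<exists>\<sigma>. \<sigma> permutes {1..l} \<and> (\<forall>j\<in>{1..<l}. f (\<sigma> j) \<le> f (\<sigma> (Suc j)))"
proof -
  define xs where "xs = sort_key f [1..<Suc l]"
  have len: "length xs = l" and set: "set xs = {1..l}" and dist: "distinct xs"
    by (auto simp: xs_def)
  have sorted: "f (xs ! i) \<le> f (xs ! k)" if "i \<le> k" "k < l" for i k
    using sorted_nth_mono[of "map f xs" i k] that by (simp add: len) (simp add: xs_def)
  define \<sigma> where "\<sigma> j = (if j \<in> {1..l} then xs ! (j - 1) else j)" for j
  have "inj_on \<sigma> {1..l}"
    using dist by (auto simp: inj_on_def \<sigma>_def nth_eq_iff_index_eq len)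
  moreover have "\<sigma> ` {1..l} \<subseteq> {1..l}"
    using set nth_mem[of _ xs] by (force simp: \<sigma>_def len)
  ultimately have "bij_betw \<sigma> {1..l} {1..l}"
    by (simp add: bij_betw_def endo_inj_surj)
  then have "\<sigma> permutes {1..l}"
    by (rule bij_imp_permutes) (simp only: \<sigma>_def if_False)
  moreover have "f (\<sigma> j) \<le> f (\<sigma> (Suc j))" if "j \<in> {1..<l}" for j
    using sorted[of "j - 1" j] that by (auto simp: \<sigma>_def)
  ultimately show ?thesis by blast
qed

text \<open>The translation reduces each charge to its residue mod \<open>e\<close>, and the
  permutation sorts these. Since residues lie in \<open>[0, e)\<close>, the wrap-around inequality
  is automatic.\<close>

lemma ex_alcove:
  assumes "e > 0" "l \<ge> 1"
  shows "\<exists>\<sigma> u. \<sigma> permutes {1..l} \<and> alcove e l (\<lambda>j. t (\<sigma> j) + int e * u j)"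
proof -
  obtain \<sigma> where \<sigma>: "\<sigma> permutes {1..l}"
    and sorted: "\<And>j. j \<in> {1..<l} \<Longrightarrow> t (\<sigma> j) mod int e \<le> t (\<sigma> (Suc j)) mod int e"
    using ex_sorting_permutation[of l "\<lambda>j. t j mod int e"] by blast
  have "t (\<sigma> j) + int e * (- (t (\<sigma> j) div int e)) = t (\<sigma> j) mod int e" for j
    by (simp add: minus_mult_div_eq_mod)
  moreover have "t (\<sigma> l) mod int e \<le> t (\<sigma> 1) mod int e + int e"
    using assms(1) pos_mod_bound[of "int e" "t (\<sigma> l)"] pos_mod_sign[of "int e" "t (\<sigma> 1)"] by linarith
  ultimately have "alcove e l (\<lambda>j. t (\<sigma> j) + int e * (- (t (\<sigma> j) div int e)))"
    using sorted by (simp only: alcove_def) blast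
  with \<sigma> show ?thesis by (intro exI[of _ \<sigma>] exI[of _ "\<lambda>j. - (t (\<sigma> j) div int e)"]) simp
qed

section \<open>The Uglov map\<close>

lemma ex_truncates:
  assumes "finite A" and "\<And>x. x \<in> A \<Longrightarrow> is_beta_set (B x)"
  shows "\<exists>m. \<forall>x\<in>A. truncates m (B x)"
proof -
  have "eventually (\<lambda>m. \<forall>x\<in>A. truncates m (B x)) at_bot"
    using assms(1) by (rule eventually_ball_finite) (use assms(2) eventually_truncates in blast)
  then show ?thesis unfolding eventually_at_bot_linorder by blast
qed

lemma sum_charge_runner_beta:
  assumes "e > 0" "lam \<in> partitions"
  shows "(\<Sum>b<e. charge (runner e (beta t lam) b)) = t"
proof -
  have "is_beta_set (runner e (beta t lam) b)" if "b \<in> {..<e}" for b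
    using that assms(2) by (simp add: is_beta_set_runner is_beta_set_beta)
  then obtain m where "\<forall>b\<in>{..<e}. truncates m (runner e (beta t lam) b)"
    using ex_truncates[of "{..<e}" "runner e (beta t lam)"] by blast
  then have m: "truncates m (runner e (beta t lam) b)" if "b < e" for b
    using that by simp
  show ?thesis
    using charge_runner[OF assms(1) m] charge_beta[OF assms(2)] by simp
qed

lemma upsilon_eq:
  "upsilon e l j x = ((x div int e) * int l + (int l - int j)) * int e + x mod int e"
  by (simp add: upsilon_def algebra_simps)

text \<open>The Uglov map only interleaves runners: runner \<open>b\<close> of component
  \<open>j\<close> becomes sub-runner \<open>l - j\<close> of runner \<open>b\<close> of the image.
  Division by \<open>e\<close> and then by \<open>l\<close> recovers \<open>b\<close> and
  \<open>j\<close> from a position.\<close>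

lemma runner_runner_uglov:
  assumes "b < e" "j \<in> {1..l}"
  shows "runner l (runner e (uglov e l Bs) b) (l - j) = runner e (Bs j) b"
proof (rule Set.set_eqI)
  fix a
  have e: "int e > 0" and b: "0 \<le> int b" "int b < int e" using assms(1) by auto
  have lj: "int (l - j) = int l - int j" using assms(2) by auto
  have "a \<in> runner l (runner e (uglov e l Bs) b) (l - j) \<longleftrightarrow>
      (\<exists>k\<in>{1..l}. \<exists>x\<in>Bs k. (a * int l + (int l - int j)) * int e + int b = upsilon e l k x)"
    by (auto simp: runner_def uglov_def lj image_iff)
  also have "\<dots> \<longleftrightarrow> a * int e + int b \<in> Bs j"
  proof
    assume "\<exists>k\<in>{1..l}. \<exists>x\<in>Bs k. (a * int l + (int l - int j)) * int e + int b = upsilon e l k x"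
    then obtain k x where k: "k \<in> {1..l}" and x: "x \<in> Bs k"
      and eq: "(a * int l + (int l - int j)) * int e + int b =
        ((x div int e) * int l + (int l - int k)) * int e + x mod int e"
      unfolding upsilon_eq by blast
    have "int b = x mod int e"
      using arg_cong[OF eq, of "\<lambda>y. y mod int e"] b by simp
    moreover from this have q: "a * int l + (int l - int j) = (x div int e) * int l + (int l - int k)"
      using eq e by simp
    have "a = x div int e"
      using arg_cong[OF q, of "\<lambda>y. y div int l"] k assms(2) by simp
    moreover from this have "j = k" using q by simp
    ultimately show "a * int e + int b \<in> Bs j" using x by simp
  next
    assume "a * int e + int b \<in> Bs j"
    moreover have "(a * int l + (int l - int j)) * int e + int b = upsilon e l j (a * int e + int b)"
      unfolding upsilon_eq using b by simp
    ultimately show "\<exists>k\<in>{1..l}. \<exists>x\<in>Bs k. (a * int l + (int l - int j)) * int e + int b = upsilon e l k x"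
      using assms(2) by blast
  qed
  also have "\<dots> \<longleftrightarrow> a \<in> runner e (Bs j) b" by (simp add: runner_def)
  finally show "a \<in> runner l (runner e (uglov e l Bs) b) (l - j) \<longleftrightarrow> a \<in> runner e (Bs j) b" .
qed

lemma sum_lessThan_reflect:
  fixes f :: "nat \<Rightarrow> int"
  shows "(\<Sum>i<l. f i) = (\<Sum>j=1..l. f (l - j))"
  by (rule sum.reindex_bij_witness[of _ "\<lambda>j. l - j" "\<lambda>i. l - i"]) auto

text \<open>\<open>charge_runner\<close> and \<open>beta_size_runner\<close> are applied to runner
  \<open>b\<close> of the image, split into its \<open>l\<close> sub-runners. The sub-runner index
  \<open>l - j\<close> supplies the linear coefficients, and \<open>sum_pairs_charges\<close> then
  collects all charge terms into pairs.\<close>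

lemma runner_uglov:
  assumes "b < e" "l \<ge> 1" and beta: "\<And>j. j \<in> {1..l} \<Longrightarrow> is_beta_set (Bs j)"
  defines "s \<equiv> \<lambda>j. charge (runner e (Bs j) b)"
  shows "charge (runner e (uglov e l Bs) b) = (\<Sum>j=1..l. s j)"
    and "2 * beta_size (runner e (uglov e l Bs) b) =
      2 * int l * (\<Sum>j=1..l. beta_size (runner e (Bs j) b)) +
      (\<Sum>j=1..l. \<Sum>i=1..<j. (s j - s i) * (s j - s i - 1))"
proof -
  let ?C = "runner e (uglov e l Bs) b"
  obtain m where m: "\<And>j. j \<in> {1..l} \<Longrightarrow> truncates m (runner e (Bs j) b)"
    using ex_truncates[of "{1..l}" "\<lambda>j. runner e (Bs j) b"] beta is_beta_set_runner[OF _ assms(1)]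
    by blast
  note run = runner_runner_uglov[OF assms(1), where Bs = Bs]
  have tr: "truncates m (runner l ?C i)" if "i < l" for i
    using run[of "l - i" l] m[of "l - i"] that by simp
  have l: "l > 0" using assms(2) by simp
  show ch: "charge ?C = (\<Sum>j=1..l. s j)"
    using charge_runner[OF l tr] by (simp add: sum_lessThan_reflect run s_def)
  have "2 * beta_size ?C = (\<Sum>j=1..l. 2 * int l * beta_size (runner e (Bs j) b) +
      int l * (s j * (s j - 1)) + 2 * int (l - j) * s j) - charge ?C * (charge ?C - 1)"
    unfolding beta_size_runner[OF l tr, simplified] sum_lessThan_reflect
    by (simp add: run s_def)
  also have "(\<Sum>j=1..l. 2 * int l * beta_size (runner e (Bs j) b) +
      int l * (s j * (s j - 1)) + 2 * int (l - j) * s j) =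
      (\<Sum>j=1..l. 2 * int l * beta_size (runner e (Bs j) b) + int l * (s j * s j)
        + int l * s j - 2 * (int j * s j))"
    by (intro sum.cong refl) (simp add: of_nat_diff algebra_simps)
  also have "\<dots> = 2 * int l * (\<Sum>j=1..l. beta_size (runner e (Bs j) b)) +
      int l * (\<Sum>j=1..l. s j * s j) + int l * (\<Sum>j=1..l. s j) - 2 * (\<Sum>j=1..l. int j * s j)"
    by (simp add: sum.distrib sum_subtractf sum_distrib_left)
  finally show "2 * beta_size ?C =
      2 * int l * (\<Sum>j=1..l. beta_size (runner e (Bs j) b)) +
      (\<Sum>j=1..l. \<Sum>i=1..<j. (s j - s i) * (s j - s i - 1))"
    unfolding ch sum_pairs_charges[symmetric] by (simp add: algebra_simps)
qed

section \<open>Cores as functions of the runner charges\<close>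

lemma mem_core_iff:
  assumes "e > 0"
  shows "x \<in> core e B \<longleftrightarrow> x div int e < charge (runner e B (nat (x mod int e)))"
proof
  assume "x div int e < charge (runner e B (nat (x mod int e)))"
  moreover have "nat (x mod int e) < e" using assms by (simp add: nat_less_iff)
  moreover have "x = (x div int e) * int e + int (nat (x mod int e))" using assms by simp
  ultimately show "x \<in> core e B" unfolding core_def by blast
qed (auto simp: core_def)

lemma is_beta_set_core:
  assumes "e > 0"
  shows "is_beta_set (core e B)"
proof -
  \<comment> \<open>A uniform bound for the charges of all runners: outside \<open>- M\<close> to
    \<open>M\<close>, in quotients by \<open>e\<close>, membership in the core is decided.\<close>
  define M where "M = (\<Sum>i<e. \<bar>charge (runner e B i)\<bar>)"
  have bound: "\<bar>charge (runner e B (nat (x mod int e)))\<bar> \<le> M" for x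
    unfolding M_def using assms
    by (intro member_le_sum[of _ _ "\<lambda>i. \<bar>charge (runner e B i)\<bar>"]) (auto simp: nat_less_iff)
  have x: "x = int e * (x div int e) + x mod int e" "0 \<le> x mod int e" "x mod int e < int e" for x
    using assms by simp_all
  have "x \<le> int e * M" if "x \<in> core e B" for x
  proof -
    have "x div int e + 1 \<le> M" using that bound[of x] unfolding mem_core_iff[OF assms] by linarith
    then have "int e * (x div int e + 1) \<le> int e * M" by (intro mult_left_mono) auto
    then show ?thesis using x[of x] unfolding distrib_left by linarith
  qed
  moreover have "x \<in> core e B" if "x < int e * (- M)" for x
  proof -
    have "int e * (x div int e) < int e * (- M)" using that x[of x] by linarith
    then have "x div int e < - M" using assms by (simp only: mult_less_cancel_left_pos of_nat_0_less_iff)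
    then show ?thesis using bound[of x] unfolding mem_core_iff[OF assms] by linarith
  qed
  ultimately show ?thesis unfolding is_beta_set_iff by blast
qed

lemma core_shift:
  assumes "e > 0" and "\<And>i. i < e \<Longrightarrow> charge (runner e B' i) = charge (runner e B i) + k"
  shows "core e B' = (+) (int e * k) ` core e B"
proof -
  have "x \<in> core e B' \<longleftrightarrow> x - int e * k \<in> core e B" for x
  proof -
    have "(x - int e * k) div int e = x div int e - k" "(x - int e * k) mod int e = x mod int e"
      using assms(1) div_mult_self2[of "int e" x "- k"] mod_mult_self2[of x "int e" "- k"] by simp_all
    then show ?thesis
      using assms by (simp add: mem_core_iff nat_less_iff) linarith
  qed
  then show ?thesis unfolding set_eq_iff mem_shift_iff by blast
qed

section \<open>The weight as an orbit invariant plus the energy\<close>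

text \<open>This is \<open>n\<close> squared times the variance of \<open>x\<close>, hence
  insensitive to adding a constant or changing the sign.\<close>

definition spread :: "nat \<Rightarrow> (nat \<Rightarrow> int) \<Rightarrow> int" where
  "spread n x = int n * (\<Sum>b<n. x b * x b) - (\<Sum>b<n. x b) * (\<Sum>b<n. x b)"

lemma spread_shift: "spread n (\<lambda>b. x b + d) = spread n x"
  by (simp add: spread_def sum.distrib algebra_simps flip: sum_distrib_left sum_distrib_right)

lemma spread_minus: "spread n (\<lambda>b. y b - x b) = spread n (\<lambda>b. x b - y b)"
  by (simp add: spread_def sum_subtractf algebra_simps)

text \<open>Isolates the dependence on the total. For differences of runner charges the total is
  \<open>t j - t i\<close>, and the first summand becomes the energy of that pair.\<close>

lemma sum_energy_eq_spread:
  "int n * (\<Sum>b<n. x b * (x b - 1)) = (\<Sum>b<n. x b) * ((\<Sum>b<n. x b) - int n) + spread n x"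
  by (simp add: spread_def sum_subtractf algebra_simps)

definition runner_charge :: "nat \<Rightarrow> (nat \<Rightarrow> nat \<Rightarrow> nat) \<Rightarrow> (nat \<Rightarrow> int) \<Rightarrow> nat \<Rightarrow> nat \<Rightarrow> int" where
  "runner_charge e lam t j b = charge (runner e (beta (t j) (lam j)) b)"

text \<open>The part of \<open>2 * e\<close> times the weight that is constant on orbits: runner
  sizes and spreads of charge differences.\<close>

definition offset :: "nat \<Rightarrow> nat \<Rightarrow> (nat \<Rightarrow> nat \<Rightarrow> nat) \<Rightarrow> (nat \<Rightarrow> int) \<Rightarrow> int" where
  "offset e l lam t =
    2 * int e * int l * (\<Sum>j=1..l. \<Sum>b<e. beta_size (runner e (beta (t j) (lam j)) b)) +
    (\<Sum>j=1..l. \<Sum>i=1..<j. spread e (\<lambda>b. runner_charge e lam t j b - runner_charge e lam t i b))"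

lemma multipartitions_beta:
  assumes "lam \<in> multipartitions l" "j \<in> {1..l}"
  shows "lam j \<in> partitions" "is_beta_set (multibeta l t lam j)"
    "multibeta l t lam j = beta (t j) (lam j)"
  using assms is_beta_set_beta by (auto simp: multipartitions_def multibeta_def PiE_iff)

lemma multiwt_eq_energy:
  assumes "e > 0" "l \<ge> 1" and lam: "lam \<in> multipartitions l"
  shows "2 * int e * multiwt e l lam t = offset e l lam t + energy e l t"
proof -
  let ?c = "runner_charge e lam t"
  let ?size = "\<lambda>j b. beta_size (runner e (beta (t j) (lam j)) b)"
  let ?U = "uglov e l (multibeta l t lam)"
  note mb = multipartitions_beta[OF lam]
  have "2 * multiwt e l lam t = (\<Sum>b<e. 2 * beta_size (runner e ?U b))"
    by (simp add: multiwt_def wt_def beta_size_def sum_distrib_left)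
  also have "\<dots> = (\<Sum>b<e. 2 * int l * (\<Sum>j=1..l. ?size j b) +
      (\<Sum>j=1..l. \<Sum>i=1..<j. (?c j b - ?c i b) * (?c j b - ?c i b - 1)))"
  proof (intro sum.cong refl)
    fix b assume "b \<in> {..<e}"
    then show "2 * beta_size (runner e ?U b) = 2 * int l * (\<Sum>j=1..l. ?size j b) +
      (\<Sum>j=1..l. \<Sum>i=1..<j. (?c j b - ?c i b) * (?c j b - ?c i b - 1))"
      using runner_uglov(2)[of b e l "multibeta l t lam"] assms(2) mb
      by (simp add: runner_charge_def)
  qed
  also have "\<dots> = 2 * int l * (\<Sum>b<e. \<Sum>j=1..l. ?size j b) +
      (\<Sum>b<e. \<Sum>j=1..l. \<Sum>i=1..<j. (?c j b - ?c i b) * (?c j b - ?c i b - 1))"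
    by (simp add: sum.distrib sum_distrib_left)
  also have "(\<Sum>b<e. \<Sum>j=1..l. ?size j b) = (\<Sum>j=1..l. \<Sum>b<e. ?size j b)" by (rule sum.swap)
  \<comment> \<open>The sum over runners moves inside the sum over pairs, so that
    \<open>sum_energy_eq_spread\<close> applies to each pair separately.\<close>
  also have "(\<Sum>b<e. \<Sum>j=1..l. \<Sum>i=1..<j. (?c j b - ?c i b) * (?c j b - ?c i b - 1)) =
      (\<Sum>j=1..l. \<Sum>i=1..<j. \<Sum>b<e. (?c j b - ?c i b) * (?c j b - ?c i b - 1))"
    by (subst sum.swap) (intro sum.cong refl sum.swap)
  finally have "int e * (2 * multiwt e l lam t) = int e * (2 * int l * (\<Sum>j=1..l. \<Sum>b<e. ?size j b)) +
      (\<Sum>j=1..l. \<Sum>i=1..<j. int e * (\<Sum>b<e. (?c j b - ?c i b) * (?c j b - ?c i b - 1)))"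
    by (simp only: distrib_left) (simp add: sum_distrib_left)
  also have "(\<Sum>j=1..l. \<Sum>i=1..<j. int e * (\<Sum>b<e. (?c j b - ?c i b) * (?c j b - ?c i b - 1))) =
      (\<Sum>j=1..l. \<Sum>i=1..<j. (t j - t i) * (t j - t i - int e) + spread e (\<lambda>b. ?c j b - ?c i b))"
  proof (intro sum.cong refl)
    fix i j assume "j \<in> {1..l}" "i \<in> {1..<j}"
    then have "(\<Sum>b<e. ?c j b - ?c i b) = t j - t i"
      using sum_charge_runner_beta[OF assms(1) mb(1)] by (simp add: sum_subtractf runner_charge_def)
    then show "int e * (\<Sum>b<e. (?c j b - ?c i b) * (?c j b - ?c i b - 1)) =
        (t j - t i) * (t j - t i - int e) + spread e (\<lambda>b. ?c j b - ?c i b)"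
      using sum_energy_eq_spread[of e "\<lambda>b. ?c j b - ?c i b"] by simp
  qed
  finally show ?thesis
    by (simp add: offset_def energy_def sum.distrib)
qed

section \<open>Invariance along an orbit\<close>

lemma weyl_orbitD:
  assumes "(nu, v) \<in> weyl_orbit e l (lam, t)"
  shows "\<exists>\<sigma> u. \<sigma> permutes {1..l} \<and>
    (\<forall>j\<in>{1..l}. nu j = lam (\<sigma> j) \<and> v j = t (\<sigma> j) + int e * u j)"
proof -
  obtain \<sigma> u where "\<sigma> permutes {1..l}" and "(nu, v) = weyl_act e l (lam, t) (\<sigma>, u)"
    using assms by (auto simp: weyl_orbit_def ext_affine_weyl_def)
  then show ?thesis by (intro exI[of _ \<sigma>] exI[of _ u]) simp
qed

lemma multipartitions_weyl_orbit:
  assumes "(nu, v) \<in> weyl_orbit e l (lam, t)" "lam \<in> multipartitions l" "t \<in> multicharges l"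
  shows "nu \<in> multipartitions l"
  using assms weyl_act_closed[of "(lam, t)" l _ e] by (auto simp: weyl_orbit_def)

context
  fixes e l :: nat and lam nu :: "nat \<Rightarrow> nat \<Rightarrow> nat" and t u v :: "nat \<Rightarrow> int" and \<sigma> :: "nat \<Rightarrow> nat"
  assumes e: "e > 0" and l: "l \<ge> 1" and lam: "lam \<in> multipartitions l" and nu: "nu \<in> multipartitions l"
    and \<sigma>: "\<sigma> permutes {1..l}" and nu_eq: "\<And>j. j \<in> {1..l} \<Longrightarrow> nu j = lam (\<sigma> j)"
    and v_eq: "\<And>j. j \<in> {1..l} \<Longrightarrow> v j = t (\<sigma> j) + int e * u j"
begin

lemma runner_beta_orbit:
  assumes "j \<in> {1..l}"
  shows "runner e (beta (v j) (nu j)) b = (+) (u j) ` runner e (beta (t (\<sigma> j)) (lam (\<sigma> j))) b"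
  unfolding nu_eq[OF assms] v_eq[OF assms] beta_shift runner_shift ..

lemma is_beta_set_runner_beta:
  assumes "j \<in> {1..l}" "b < e"
  shows "is_beta_set (runner e (beta (t (\<sigma> j)) (lam (\<sigma> j))) b)"
  using multipartitions_beta(1)[OF lam, of "\<sigma> j"] assms permutes_in_image[OF \<sigma>, of j]
  by (simp add: is_beta_set_runner is_beta_set_beta)

lemma runner_charge_orbit:
  assumes "j \<in> {1..l}" "b < e"
  shows "runner_charge e nu v j b = runner_charge e lam t (\<sigma> j) b + u j"
  unfolding runner_charge_def runner_beta_orbit[OF assms(1)]
  by (rule charge_shift[OF is_beta_set_runner_beta[OF assms]])

lemma offset_orbit: "offset e l nu v = offset e l lam t"
proof -
  let ?size = "\<lambda>j b. beta_size (runner e (beta (t j) (lam j)) b)"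
  let ?c = "runner_charge e lam t"
  have "(\<Sum>j=1..l. \<Sum>b<e. beta_size (runner e (beta (v j) (nu j)) b)) =
      (\<Sum>j=1..l. \<Sum>b<e. ?size (\<sigma> j) b)"
    by (intro sum.cong refl)
      (simp only: runner_beta_orbit beta_size_shift is_beta_set_runner_beta lessThan_iff)
  also have "\<dots> = (\<Sum>j=1..l. \<Sum>b<e. ?size j b)"
    using sum.permute[OF \<sigma>, of "\<lambda>j. \<Sum>b<e. ?size j b"] by (simp add: o_def)
  finally have sizes: "(\<Sum>j=1..l. \<Sum>b<e. beta_size (runner e (beta (v j) (nu j)) b)) =
      (\<Sum>j=1..l. \<Sum>b<e. ?size j b)" .
  have "spread e (\<lambda>b. runner_charge e nu v j b - runner_charge e nu v i b) =
      spread e (\<lambda>b. ?c (\<sigma> j) b - ?c (\<sigma> i) b)" if "j \<in> {1..l}" "i \<in> {1..<j}" for i j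
  proof -
    have "spread e (\<lambda>b. runner_charge e nu v j b - runner_charge e nu v i b) =
        spread e (\<lambda>b. ?c (\<sigma> j) b - ?c (\<sigma> i) b + (u j - u i))"
      \<comment> \<open>Each runner charge of component \<open>j\<close> moves by
        \<open>u j\<close>, so the difference moves by \<open>u j - u i\<close>, independently of
        \<open>b\<close>.\<close>
      using that by (simp add: spread_def runner_charge_orbit algebra_simps)
    then show ?thesis by (simp only: spread_shift)
  qed
  then have "(\<Sum>j=1..l. \<Sum>i=1..<j. spread e (\<lambda>b. runner_charge e nu v j b - runner_charge e nu v i b)) =
      (\<Sum>j=1..l. \<Sum>i=1..<j. spread e (\<lambda>b. ?c (\<sigma> j) b - ?c (\<sigma> i) b))"
    by (intro sum.cong refl) simp
  also have "\<dots> = (\<Sum>j=1..l. \<Sum>i=1..<j. spread e (\<lambda>b. ?c j b - ?c i b))"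
    by (rule sum_pairs_permute[OF spread_minus \<sigma>])
  finally show ?thesis unfolding offset_def sizes by simp
qed

text \<open>The charge of every runner of the Uglov image changes by the same total of the
  \<open>u j\<close>. The core is therefore translated as a whole, which \<open>beta_inv\<close>
  does not see.\<close>

lemma multicore_orbit: "multicore e l nu v = multicore e l lam t"
proof -
  let ?U = "uglov e l (multibeta l t lam)" and ?U' = "uglov e l (multibeta l v nu)"
  have "charge (runner e ?U' b) = charge (runner e ?U b) + (\<Sum>j=1..l. u j)" if "b < e" for b
  proof -
    have "charge (runner e ?U' b) = (\<Sum>j=1..l. runner_charge e nu v j b)"
      using runner_uglov(1)[OF that l, of "multibeta l v nu"] multipartitions_beta[OF nu]
      by (simp add: runner_charge_def)
    also have "\<dots> = (\<Sum>j=1..l. runner_charge e lam t (\<sigma> j) b + u j)"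
      using that by (intro sum.cong refl runner_charge_orbit)
    also have "\<dots> = (\<Sum>j=1..l. runner_charge e lam t j b) + (\<Sum>j=1..l. u j)"
      using sum.permute[OF \<sigma>, of "\<lambda>j. runner_charge e lam t j b"] by (simp add: sum.distrib o_def)
    also have "(\<Sum>j=1..l. runner_charge e lam t j b) = charge (runner e ?U b)"
      using runner_uglov(1)[OF that l, of "multibeta l t lam"] multipartitions_beta[OF lam]
      by (simp add: runner_charge_def)
    finally show ?thesis .
  qed
  from core_shift[OF e this] show ?thesis
    unfolding multicore_def by (simp only: beta_inv_shift is_beta_set_core[OF e])
qed

end

section \<open>Equality of cores and the minimal weight\<close>

theorem theorem3p6:
  fixes e l :: nat and lam mu :: "nat \<Rightarrow> nat \<Rightarrow> nat" and t u :: "nat \<Rightarrow> int"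
  assumes "e \<ge> 2" and "l \<ge> 1"
    and "lam \<in> multipartitions l" and "t \<in> multicharges l"
    and "(mu, u) \<in> weyl_orbit e l (lam, t)"
  shows "multicore e l mu u = multicore e l lam t \<and>
    (is_minimum {multiwt e l nu v | nu v. (nu, v) \<in> weyl_orbit e l (lam, t)} (multiwt e l mu u)
      \<longleftrightarrow> (\<forall>j\<in>{1..<l}. u j \<le> u (Suc j)) \<and> u l \<le> u 1 + int e)"
proof -
  have e: "e > 0" using assms(1) by simp
  \<comment> \<open>The lower bound for \<open>2 * e\<close> times the weight, the same for every
    element of the orbit and reached exactly on the alcove.\<close>
  define K where "K = offset e l lam t + residue_energy e l t"
  have wt: "K \<le> 2 * int e * multiwt e l nu v \<and> (2 * int e * multiwt e l nu v = K \<longleftrightarrow> alcove e l v)"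
    if orb: "(nu, v) \<in> weyl_orbit e l (lam, t)" for nu v
  proof -
    have nu: "nu \<in> multipartitions l"
      using multipartitions_weyl_orbit[OF orb assms(3,4)] .
    obtain \<sigma> w where \<sigma>: "\<sigma> permutes {1..l}"
      and act: "\<forall>j\<in>{1..l}. nu j = lam (\<sigma> j) \<and> v j = t (\<sigma> j) + int e * w j"
      using weyl_orbitD[OF orb] by blast
    have "offset e l nu v = offset e l lam t"
      by (rule offset_orbit[OF e assms(2,3) nu \<sigma>]) (use act in blast)+
    then have "2 * int e * multiwt e l nu v = offset e l lam t + energy e l v"
      by (simp add: multiwt_eq_energy[OF e assms(2) nu])
    moreover have "residue_energy e l v = residue_energy e l t"
      by (rule residue_energy_orbit[OF \<sigma>]) (use act in blast)
    ultimately show ?thesis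
      using residue_energy_le_energy[OF e, of l v] residue_energy_eq_energy_iff[OF e assms(2), of v]
      by (auto simp: K_def)
  qed
  obtain \<sigma> w where \<sigma>: "\<sigma> permutes {1..l}" and alc: "alcove e l (\<lambda>j. t (\<sigma> j) + int e * w j)"
    using ex_alcove[OF e assms(2)] by blast
  \<comment> \<open>The alcove charge as an actual orbit element; \<open>restrict\<close> makes the
    translation an extensional tuple, as the carrier of the group demands.\<close>
  define nu v where "nu = tuple_perm l lam \<sigma>"
    and "v = (\<lambda>j\<in>{1..l}. tuple_perm l t \<sigma> j + int e * restrict w {1..l} j)"
  have orb: "(nu, v) \<in> weyl_orbit e l (lam, t)"
    unfolding weyl_orbit_def using \<sigma>
    by (intro image_eqI[of _ _ "(\<sigma>, restrict w {1..l})"]) (auto simp: nu_def v_def ext_affine_weyl_def)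
  have "alcove e l v" using alc assms(2) by (simp add: alcove_def v_def)
  then have attained: "2 * int e * multiwt e l nu v = K" using wt[OF orb] by simp
  have "is_minimum {multiwt e l nu v | nu v. (nu, v) \<in> weyl_orbit e l (lam, t)} (multiwt e l mu u)
      \<longleftrightarrow> alcove e l u"
  proof
    assume "is_minimum {multiwt e l nu v | nu v. (nu, v) \<in> weyl_orbit e l (lam, t)} (multiwt e l mu u)"
    then have "multiwt e l mu u \<le> multiwt e l nu v" using orb unfolding is_minimum_def by blast
    then have "2 * int e * multiwt e l mu u \<le> 2 * int e * multiwt e l nu v"
      by (intro mult_left_mono) auto
    \<comment> \<open>A minimal weight is at most the attained value \<open>K\<close> and at least
      \<open>K\<close>, so the equality case applies.\<close>
    then show "alcove e l u" using wt[OF assms(5)] attained by auto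
  next
    assume "alcove e l u"
    then have "2 * int e * multiwt e l mu u \<le> 2 * int e * multiwt e l nu' v'"
      if "(nu', v') \<in> weyl_orbit e l (lam, t)" for nu' v'
      using wt[OF assms(5)] wt[OF that] by simp
    then have "multiwt e l mu u \<le> multiwt e l nu' v'"
      if "(nu', v') \<in> weyl_orbit e l (lam, t)" for nu' v'
      using that e by (simp add: mult_le_cancel_left)
    then show "is_minimum {multiwt e l nu v | nu v. (nu, v) \<in> weyl_orbit e l (lam, t)} (multiwt e l mu u)"
      using assms(5) unfolding is_minimum_def by blast
  qed
  moreover have "multicore e l mu u = multicore e l lam t"
  proof -
    obtain \<sigma> w where \<sigma>: "\<sigma> permutes {1..l}"
      and act: "\<forall>j\<in>{1..l}. mu j = lam (\<sigma> j) \<and> u j = t (\<sigma> j) + int e * w j"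
      using weyl_orbitD[OF assms(5)] by blast
    show ?thesis
      by (rule multicore_orbit[OF e assms(2,3) multipartitions_weyl_orbit[OF assms(5,3,4)] \<sigma>])
        (use act in blast)+
  qed
  ultimately show ?thesis by (simp add: alcove_def)
qed

end
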